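(* Let $\mathcal B=(e_n)_{n=1}^\infty$ be a basis in a Banach space $\mathbb X$. (a) If $\mathcal B$ is almost-greedy with constant $C_{al}$, then $\mathcal B$ has the Property (F$^*$) with constant $\mathcal F^*\leq C_{al}(1+2C_{al})$. (b) If $\mathcal B$ has the Property (F$^*$) with constant $\mathcal F^*$, then $\mathcal B$ is almost-greedy with constant $C_{al}\leq (\mathcal F^* )^2$.
   Context: $(\mathbb X,\|\cdot\|)$ is a Banach space over $\mathbb F=\mathbb R$ or $\mathbb C$. A basis means a semi-normalized Markushevich basis: a sequence $\mathcal B=(e_n)_{n=1}^\infty\subset\mathbb X$ with closed linear span $\mathbb X$ for which there is a unique sequence $(e_n^* )_{n=1}^\infty\subset\mathbb X^*$ with $e_n^*(e_m)=\delta_{n,m}$, such that $e_n^*(f)=0$ for all $n$ implies $f=0$, and $0<\inf_n\min\{\|e_n\|,\|e_n^*\|\}\le\sup_n\max\{\|e_n\|,\|e_n^*\|\}<\infty$. Notation: $\mathrm{supp}(f)=\{n: e_n^*(f)\ne0\}$; $\mathbb X_{fin}$ is the subspace of elements with finite support; $f\cdot g=0$ means $\mathrm{supp}(f)\cap\mathrm{supp}(g)=\emptyset$; $\tilde f=(e_n^*(f))_n$ and $\|\tilde f\|_\infty=\sup_n|e_n^*(f)|$; for a finite set $B\subset\mathbb N$, $P_B(f)=\sum_{n\in B}e_n^*(f)e_n$. An infimum over the empty set is $+\infty$. A greedy set of order $m$ for $f\in\mathbb X$ is a set $A\subset\mathbb N$ with $|A|=m$ and $\min_{n\in A}|e_n^*(f)|\ge\max_{n\notin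 A}|e_n^*(f)|$; $\mathcal G_m(f)=P_A(f)$ for such a set $A$ is called a greedy sum of order $m$. Almost-greedy: there is $C>0$ with $\|f-\mathcal G_m(f)\|\le C\inf\{\|f-P_B(f)\|: |B|\le m\}$ for all $m\in\mathbb N$, all $f\in\mathbb X$ and every greedy sum $\mathcal G_m(f)$; the least such constant is $C_{al}$. Property (F$^*$): there is $C>0$ such that $\|f+z\|\le C\|f+y\|$ for all $f,z,y\in\mathbb X_{fin}$ satisfying: (i) $f\cdot z=0$, $f\cdot y=0$, $z\cdot y=0$; (ii) $\max\{\|\tilde f\|_\infty,\|\tilde z\|_\infty\}\le1$; (iii) $|D|\ge|\mathrm{supp}(z)|$, where $D=\{n\in\mathrm{supp}(y): |e_n^*(y)|=1\}$; (iv) $\inf_{n\in\mathrm{supp}(y)}|e_n^*(y)|\ge\|\tilde f\|_\infty$. The least such constant is $\mathcal F^*$. *)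

theory Defs
  imports "HOL-Analysis.Analysis"
begin

(* Banach spaces over F = R or C.  The distribution only has a class of real Banach spaces, so
   the F-structure is an explicit scalar multiplication extending scaleR.  The scalar type ranges
   over the class real_normed_field, of which real and complex are instances; by the
   Gelfand-Mazur theorem every instance is isometrically isomorphic to one of these two. *)

locale banach_space_over = vector_space smul
  for smul :: "'k::real_normed_field \<Rightarrow> 'a::banach \<Rightarrow> 'a" +
  assumes smul_of_real: "smul (of_real r) x = r *\<^sub>R x"
    and norm_smul: "norm (smul c x) = norm c * norm x"

lemma banach_space_over_scaleR: "banach_space_over (scaleR :: real \<Rightarrow> 'a::banach \<Rightarrow> 'a)"
  by unfold_locales (auto simp: algebra_simps)

definition dual_space :: "('k::real_normed_field \<Rightarrow> 'a::banach \<Rightarrow> 'a) \<Rightarrow> ('a \<Rightarrow> 'k) set" where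
  "dual_space smul = {\<phi>. bounded_linear \<phi> \<and> (\<forall>c x. \<phi> (smul c x) = c * \<phi> x)}"

definition biorthogonal ::
  "('k::real_normed_field \<Rightarrow> 'a::banach \<Rightarrow> 'a) \<Rightarrow> (nat \<Rightarrow> 'a) \<Rightarrow> (nat \<Rightarrow> 'a \<Rightarrow> 'k) \<Rightarrow> bool" where
  "biorthogonal smul e es \<longleftrightarrow>
     (\<forall>n. es n \<in> dual_space smul) \<and> (\<forall>n m. es n (e m) = (if n = m then 1 else 0))"

(* coord smul e n f is e_n^*(f); meaningful when the biorthogonal sequence is unique. *)
definition coord ::
  "('k::real_normed_field \<Rightarrow> 'a::banach \<Rightarrow> 'a) \<Rightarrow> (nat \<Rightarrow> 'a) \<Rightarrow> nat \<Rightarrow> 'a \<Rightarrow> 'k" where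
  "coord smul e = (THE es. biorthogonal smul e es)"

(* Semi-normalized Markushevich basis, indexed from 0.  The norm of a functional in the dual is
   its operator norm onorm. *)
definition semi_normalized_M_basis ::
  "('k::real_normed_field \<Rightarrow> 'a::banach \<Rightarrow> 'a) \<Rightarrow> (nat \<Rightarrow> 'a) \<Rightarrow> bool" where
  "semi_normalized_M_basis smul e \<longleftrightarrow>
     closure (module.span smul (range e)) = UNIV \<and>
     (\<exists>!es. biorthogonal smul e es) \<and>
     (\<forall>f. (\<forall>n. coord smul e n f = 0) \<longrightarrow> f = 0) \<and>
     0 < (INF n. min (norm (e n)) (onorm (coord smul e n))) \<and>
     bdd_above (range (\<lambda>n. max (norm (e n)) (onorm (coord smul e n))))"

definition supp ::
  "('k::real_normed_field \<Rightarrow> 'a::banach \<Rightarrow> 'a) \<Rightarrow> (nat \<Rightarrow> 'a) \<Rightarrow> 'a \<Rightarrow> nat set" where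
  "supp smul e f = {n. coord smul e n f \<noteq> 0}"

definition X_fin ::
  "('k::real_normed_field \<Rightarrow> 'a::banach \<Rightarrow> 'a) \<Rightarrow> (nat \<Rightarrow> 'a) \<Rightarrow> 'a set" where
  "X_fin smul e = {f. finite (supp smul e f)}"

(* The supremum is over a bounded set whenever e is a semi-normalized basis. *)
definition coord_sup ::
  "('k::real_normed_field \<Rightarrow> 'a::banach \<Rightarrow> 'a) \<Rightarrow> (nat \<Rightarrow> 'a) \<Rightarrow> 'a \<Rightarrow> real" where
  "coord_sup smul e f = (SUP n. norm (coord smul e n f))"

definition proj ::
  "('k::real_normed_field \<Rightarrow> 'a::banach \<Rightarrow> 'a) \<Rightarrow> (nat \<Rightarrow> 'a) \<Rightarrow> nat set \<Rightarrow> 'a \<Rightarrow> 'a" where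
  "proj smul e B f = (\<Sum>n\<in>B. smul (coord smul e n f) (e n))"

definition greedy_set ::
  "('k::real_normed_field \<Rightarrow> 'a::banach \<Rightarrow> 'a) \<Rightarrow> (nat \<Rightarrow> 'a) \<Rightarrow> nat \<Rightarrow> 'a \<Rightarrow> nat set \<Rightarrow> bool" where
  "greedy_set smul e m f A \<longleftrightarrow>
     finite A \<and> card A = m \<and>
     (\<forall>n\<in>A. \<forall>k\<in>- A. norm (coord smul e n f) \<ge> norm (coord smul e k f))"

definition greedy_sums ::
  "('k::real_normed_field \<Rightarrow> 'a::banach \<Rightarrow> 'a) \<Rightarrow> (nat \<Rightarrow> 'a) \<Rightarrow> nat \<Rightarrow> 'a \<Rightarrow> 'a set" where
  "greedy_sums smul e m f = {proj smul e A f |A. greedy_set smul e m f A}"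

definition almost_greedy_with ::
  "('k::real_normed_field \<Rightarrow> 'a::banach \<Rightarrow> 'a) \<Rightarrow> (nat \<Rightarrow> 'a) \<Rightarrow> real \<Rightarrow> bool" where
  "almost_greedy_with smul e C \<longleftrightarrow>
     C > 0 \<and>
     (\<forall>m f. \<forall>g\<in>greedy_sums smul e m f.
        norm (f - g) \<le> C * (INF B\<in>{B. finite B \<and> card B \<le> m}. norm (f - proj smul e B f)))"

definition almost_greedy ::
  "('k::real_normed_field \<Rightarrow> 'a::banach \<Rightarrow> 'a) \<Rightarrow> (nat \<Rightarrow> 'a) \<Rightarrow> bool" where
  "almost_greedy smul e \<longleftrightarrow> (\<exists>C. almost_greedy_with smul e C)"

(* For an almost-greedy basis the infimum is attained: admissible constants are at least 1 and
   the defining inequalities are closed in C.  The same holds for Fstar_const. *)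
definition C_al ::
  "('k::real_normed_field \<Rightarrow> 'a::banach \<Rightarrow> 'a) \<Rightarrow> (nat \<Rightarrow> 'a) \<Rightarrow> real" where
  "C_al smul e = Inf {C. almost_greedy_with smul e C}"

(* Admissible triples (f, z, y).  The infimum in the last clause is taken in ereal, so that it is
   infinity, and the clause void, when y = 0. *)
definition Fstar_admissible ::
  "('k::real_normed_field \<Rightarrow> 'a::banach \<Rightarrow> 'a) \<Rightarrow> (nat \<Rightarrow> 'a) \<Rightarrow> 'a \<Rightarrow> 'a \<Rightarrow> 'a \<Rightarrow> bool" where
  "Fstar_admissible smul e f z y \<longleftrightarrow>
     supp smul e f \<inter> supp smul e z = {} \<and>
     supp smul e f \<inter> supp smul e y = {} \<and>
     supp smul e z \<inter> supp smul e y = {} \<and>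
     max (coord_sup smul e f) (coord_sup smul e z) \<le> 1 \<and>
     card {n \<in> supp smul e y. norm (coord smul e n y) = 1} \<ge> card (supp smul e z) \<and>
     (INF n\<in>supp smul e y. ereal (norm (coord smul e n y))) \<ge> ereal (coord_sup smul e f)"

definition property_Fstar_with ::
  "('k::real_normed_field \<Rightarrow> 'a::banach \<Rightarrow> 'a) \<Rightarrow> (nat \<Rightarrow> 'a) \<Rightarrow> real \<Rightarrow> bool" where
  "property_Fstar_with smul e C \<longleftrightarrow>
     C > 0 \<and>
     (\<forall>f\<in>X_fin smul e. \<forall>z\<in>X_fin smul e. \<forall>y\<in>X_fin smul e.
        Fstar_admissible smul e f z y \<longrightarrow> norm (f + z) \<le> C * norm (f + y))"

definition property_Fstar ::
  "('k::real_normed_field \<Rightarrow> 'a::banach \<Rightarrow> 'a) \<Rightarrow> (nat \<Rightarrow> 'a) \<Rightarrow> bool" where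
  "property_Fstar smul e \<longleftrightarrow> (\<exists>C. property_Fstar_with smul e C)"

definition Fstar_const ::
  "('k::real_normed_field \<Rightarrow> 'a::banach \<Rightarrow> 'a) \<Rightarrow> (nat \<Rightarrow> 'a) \<Rightarrow> real" where
  "Fstar_const smul e = Inf {C. property_Fstar_with smul e C}"

end

theory Submission
  imports Defs
begin

text \<open>
  Write \<open>e\<^sub>n\<^sup>*\<close> for the coordinate functionals and \<open>P\<^sub>A\<close> for the coordinate projections.

  From almost-greedy to \<open>F\<^sup>*\<close>. In the vector \<open>f + y\<close> every coordinate of \<open>y\<close> dominates every
  coordinate of \<open>f\<close>, so \<open>supp y\<close> is a greedy set and \<open>f\<close> is a greedy remainder:
  \<open>\<parallel>f\<parallel> \<le> C \<parallel>f + y\<parallel>\<close>. The set \<open>D\<close> where \<open>y\<close> has modulus one is the difference of the greedy sets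
  \<open>{|y\<^sub>n| \<ge> 1}\<close> and \<open>{|y\<^sub>n| > 1}\<close> of \<open>f + y\<close>, so \<open>\<parallel>P\<^sub>D y\<parallel> \<le> 2C \<parallel>f + y\<parallel>\<close>. Finally \<open>D\<close> is a greedy
  set of \<open>z + P\<^sub>D y\<close>, and comparing its remainder \<open>z\<close> with the remainder \<open>P\<^sub>D y\<close> of the set \<open>supp z\<close>,
  which is not larger, gives \<open>\<parallel>z\<parallel> \<le> C \<parallel>P\<^sub>D y\<parallel>\<close>. Adding up, \<open>\<parallel>f + z\<parallel> \<le> C (1 + 2C) \<parallel>f + y\<parallel>\<close>.

  From \<open>F\<^sup>*\<close> to almost-greedy. Let \<open>A\<close> be a greedy set of \<open>f\<close>, let \<open>|B| \<le> |A|\<close>, and let \<open>t\<close>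
  separate the moduli of the coordinates on \<open>A\<close> from those off \<open>A\<close>. If \<open>t = 0\<close>, then \<open>f = P\<^sub>A f\<close> and
  there is nothing to prove; so let \<open>t > 0\<close>. With \<open>g = f - P\<^bsub>A \<union> B\<^esub> f\<close> the two
  vectors to compare are \<open>g + P\<^bsub>B - A\<^esub> f\<close> and \<open>g + P\<^bsub>A - B\<^esub> f\<close>. Between them stands \<open>g + y\<close>, where \<open>y\<close>
  is \<open>P\<^bsub>A - B\<^esub> f\<close> with each coordinate cut down to modulus \<open>t\<close>. Passing from \<open>g + y\<close> to
  \<open>g + P\<^bsub>B - A\<^esub> f\<close> is an instance of \<open>F\<^sup>*\<close> rescaled by \<open>t\<close>, because all coordinates of \<open>y\<close> have modulus
  exactly \<open>t\<close> and \<open>|B - A| \<le> |A - B|\<close>. For the other passage, \<open>g + y\<close> is a convex combination of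
  vectors obtained from \<open>g + P\<^bsub>A - B\<^esub> f\<close> by deleting its largest coordinates, and \<open>F\<^sup>*\<close> with \<open>z = 0\<close>
  says that such deletions cost at most a factor \<open>C\<close>. The total is \<open>C\<^sup>2\<close>.

  Property \<open>F\<^sup>*\<close> speaks of finitely supported vectors, whereas almost-greediness speaks of all
  vectors, and \<open>g\<close> may have infinite support. But in the inequality \<open>\<parallel>f + z\<parallel> \<le> C \<parallel>f + y\<parallel>\<close> a vector \<open>f\<close>
  with infinite support is a limit of finitely supported vectors that still avoid the finite
  supports of \<open>z\<close> and \<open>y\<close> and whose coordinates do not exceed the supremum of those of \<open>f\<close>, so the
  inequality persists by continuity.
\<close>

section \<open>Convex combinations and infima\<close>

text \<open>
  The scalars \<open>l\<close> have layers \<open>{n. l n \<ge> s}\<close>, and \<open>\<Sum> l n x n\<close> is the average of the sums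
  of \<open>x\<close> over these layers. The induction peels off the element of least weight instead of integrating
  over \<open>s\<close>. As it peels off one element at a time even among equal weights, the sets that occur are
  layers only up to ties, and the hypothesis has to cover all of these.
\<close>
lemma norm_layered_combination_le:
  fixes x :: "'i \<Rightarrow> 'v::real_normed_vector" and l :: "'i \<Rightarrow> real"
  assumes "finite A"
    and "\<And>n. n \<in> A \<Longrightarrow> 0 \<le> l n \<and> l n \<le> 1"
    and "\<And>S. S \<subseteq> A \<Longrightarrow> (\<And>k n. k \<in> S \<Longrightarrow> n \<in> A - S \<Longrightarrow> l n \<le> l k) \<Longrightarrow> norm (g + (\<Sum>n\<in>S. x n)) \<le> M"
  shows "norm (g + (\<Sum>n\<in>A. l n *\<^sub>R x n)) \<le> M"
  using assms
proof (induction A arbitrary: l rule: finite_psubset_induct)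
  case (psubset A)
  have whole: "norm (g + (\<Sum>n\<in>A. x n)) \<le> M"
    by (rule psubset.prems(2)) auto
  show ?case
  proof (cases "A = {}")
    case True
    then show ?thesis using whole by simp
  next
    case False
    then obtain a where a: "a \<in> A" "\<And>n. n \<in> A \<Longrightarrow> l a \<le> l n"
      using psubset.hyps arg_min_if_finite(1)[of A l] arg_min_least[of A _ l] by blast
    show ?thesis
    proof (cases "l a = 1")
      case True
      have "l n = 1" if "n \<in> A" for n
        using psubset.prems(1)[OF that] a(2)[OF that] True by simp
      then show ?thesis using whole by simp
    next
      case False
      then have la: "0 \<le> l a" "l a < 1" using psubset.prems(1)[OF a(1)] by auto
      define \<mu> where "\<mu> = (\<lambda>n. (l n - l a) / (1 - l a))"
      have rest: "norm (g + (\<Sum>n\<in>A-{a}. \<mu> n *\<^sub>R x n)) \<le> M"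
      proof (rule psubset.IH)
        show "A - {a} \<subset> A" using a(1) by auto
        show "0 \<le> \<mu> n \<and> \<mu> n \<le> 1" if "n \<in> A - {a}" for n
          using that psubset.prems(1)[of n] a(2)[of n] la by (auto simp: \<mu>_def)
        show "norm (g + (\<Sum>n\<in>S. x n)) \<le> M"
          if S: "S \<subseteq> A - {a}" "\<And>k n. k \<in> S \<Longrightarrow> n \<in> A - {a} - S \<Longrightarrow> \<mu> n \<le> \<mu> k" for S
        proof (rule psubset.prems(2))
          show "S \<subseteq> A" using S(1) by auto
          fix k n assume kn: "k \<in> S" "n \<in> A - S"
          show "l n \<le> l k"
          proof (cases "n = a")
            case True
            then show ?thesis using a(2) kn(1) S(1) by auto
          next
            case False
            then have "\<mu> n \<le> \<mu> k" using S(2) kn by auto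
            then show ?thesis using la by (simp add: \<mu>_def divide_le_cancel)
          qed
        qed
      qed
      have "(\<Sum>n\<in>A. l n *\<^sub>R x n) = (\<Sum>n\<in>A. l a *\<^sub>R x n + (1 - l a) *\<^sub>R \<mu> n *\<^sub>R x n)"
        by (rule sum.cong) (use la in \<open>auto simp: \<mu>_def simp flip: scaleR_add_left\<close>)
      also have "\<dots> = l a *\<^sub>R (\<Sum>n\<in>A. x n) + (1 - l a) *\<^sub>R (\<Sum>n\<in>A. \<mu> n *\<^sub>R x n)"
        by (simp add: sum.distrib scaleR_sum_right)
      also have "(\<Sum>n\<in>A. \<mu> n *\<^sub>R x n) = (\<Sum>n\<in>A-{a}. \<mu> n *\<^sub>R x n)"
        by (rule sum.mono_neutral_right) (use psubset.hyps in \<open>auto simp: \<mu>_def\<close>)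
      finally have "g + (\<Sum>n\<in>A. l n *\<^sub>R x n) =
          l a *\<^sub>R (g + (\<Sum>n\<in>A. x n)) + (1 - l a) *\<^sub>R (g + (\<Sum>n\<in>A-{a}. \<mu> n *\<^sub>R x n))"
        by (simp add: algebra_simps)
      also have "norm \<dots> \<le> l a * norm (g + (\<Sum>n\<in>A. x n))
          + (1 - l a) * norm (g + (\<Sum>n\<in>A-{a}. \<mu> n *\<^sub>R x n))"
        using la by (intro norm_triangle_le) simp
      also have "\<dots> \<le> l a * M + (1 - l a) * M"
        using la whole rest by (intro add_mono mult_left_mono) auto
      finally show ?thesis by (simp add: algebra_simps)
    qed
  qed
qed

text \<open>
  The best constant of a property is an infimum of admissible ones; a bound in terms of
  every admissible constant is therefore a bound in terms of the best one.
\<close>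
lemma le_continuous_at_Inf:
  fixes S :: "real set" and \<phi> :: "real \<Rightarrow> real"
  assumes "S \<noteq> {}" "bdd_below S" "continuous_on UNIV \<phi>" "\<And>C. C \<in> S \<Longrightarrow> r \<le> \<phi> C"
  shows "r \<le> \<phi> (Inf S)"
proof -
  have "closed {C. r \<le> \<phi> C}"
    using assms(3) by (intro closed_Collect_le continuous_on_const)
  then have "closure S \<subseteq> {C. r \<le> \<phi> C}"
    using assms(4) by (intro closure_minimal) auto
  then show ?thesis
    using closure_contains_Inf[OF assms(1,2)] by auto
qed

section \<open>Coordinates with respect to a Markushevich basis\<close>

locale M_basis_over = banach_space_over smul
  for smul :: "'k::real_normed_field \<Rightarrow> 'a::banach \<Rightarrow> 'a" +
  fixes e :: "nat \<Rightarrow> 'a"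
  assumes basis: "semi_normalized_M_basis smul e"
begin

abbreviation "co \<equiv> coord smul e"
abbreviation "spt \<equiv> supp smul e"
abbreviation "P \<equiv> proj smul e"

lemma biorthogonal_coord: "biorthogonal smul e co"
proof -
  have "\<exists>!es. biorthogonal smul e es" using basis by (simp add: semi_normalized_M_basis_def)
  then show ?thesis unfolding coord_def by (rule theI')
qed

lemma bounded_linear_coord: "bounded_linear (co n)"
  using biorthogonal_coord by (auto simp: biorthogonal_def dual_space_def)

lemma coord_smul: "co n (smul c x) = c * co n x"
  using biorthogonal_coord by (auto simp: biorthogonal_def dual_space_def)

lemma coord_basis: "co n (e m) = (if n = m then 1 else 0)"
  using biorthogonal_coord by (auto simp: biorthogonal_def)

lemma coord_linear:
  "co n (x + y) = co n x + co n y" "co n (x - y) = co n x - co n y" "co n 0 = 0"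
  "co n (r *\<^sub>R x) = r *\<^sub>R co n x" "co n (\<Sum>i\<in>I. h i) = (\<Sum>i\<in>I. co n (h i))"
proof -
  interpret bounded_linear "co n" by (rule bounded_linear_coord)
  show "co n (x + y) = co n x + co n y" "co n (x - y) = co n x - co n y" "co n 0 = 0"
    "co n (r *\<^sub>R x) = r *\<^sub>R co n x" "co n (\<Sum>i\<in>I. h i) = (\<Sum>i\<in>I. co n (h i))"
    by (simp_all add: add diff scaleR sum)
qed

lemma coord_eqI: "(\<And>n. co n f = co n g) \<Longrightarrow> f = g"
  using basis[unfolded semi_normalized_M_basis_def] coord_linear(2)[of _ f g]
  by (metis eq_iff_diff_eq_0)

lemma coord_uniform_bound: "\<exists>K>0. \<forall>n x. norm (co n x) \<le> K * norm x"
proof -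
  obtain K where "\<And>n. max (norm (e n)) (onorm (co n)) \<le> K"
    using basis by (auto simp: semi_normalized_M_basis_def bdd_above_def)
  then have K: "onorm (co n) \<le> max K 1" for n
    by (metis max.boundedE max.coboundedI1)
  have "norm (co n x) \<le> max K 1 * norm x" for n x
    using onorm[OF bounded_linear_coord, of n x] mult_right_mono[OF K norm_ge_zero]
    by (rule order_trans)
  moreover have "max K 1 > 0" by simp
  ultimately show ?thesis by blast
qed

lemma coord_le_coord_sup: "norm (co n f) \<le> coord_sup smul e f"
proof -
  obtain K where "K > 0" "\<And>n x. norm (co n x) \<le> K * norm x"
    using coord_uniform_bound by blast
  then show ?thesis unfolding coord_sup_def
    by (intro cSUP_upper bdd_aboveI[of _ "K * norm f"]) auto
qed

lemma coord_sup_le_iff: "coord_sup smul e f \<le> r \<longleftrightarrow> (\<forall>n. norm (co n f) \<le> r)"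
proof
  show "\<forall>n. norm (co n f) \<le> r" if "coord_sup smul e f \<le> r"
    using that coord_le_coord_sup[of _ f] order_trans by blast
qed (auto simp: coord_sup_def intro: cSUP_least)

lemma coord_combination:
  "finite A \<Longrightarrow> co n (\<Sum>k\<in>A. smul (c k) (e k)) = (if n \<in> A then c n else 0)"
  by (simp add: coord_linear coord_smul coord_basis mult_delta_right)

lemma coord_proj: "finite B \<Longrightarrow> co n (P B f) = (if n \<in> B then co n f else 0)"
  unfolding proj_def by (rule coord_combination)

lemma tendsto_smul_left: "(u \<longlongrightarrow> c) F \<Longrightarrow> ((\<lambda>i. smul (u i) x) \<longlongrightarrow> smul c x) F"
proof -
  assume "(u \<longlongrightarrow> c) F"
  then have "((\<lambda>i. norm (u i - c) * norm x) \<longlongrightarrow> 0) F"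
    by (simp add: LIM_zero tendsto_norm_zero tendsto_mult_left_zero)
  moreover have "smul (u i) x - smul c x = smul (u i - c) x" for i
    by (simp add: scale_left_diff_distrib)
  ultimately have "((\<lambda>i. smul (u i) x - smul c x) \<longlongrightarrow> 0) F"
    by (intro tendsto_norm_zero_cancel[of "\<lambda>i. smul (u i) x - smul c x"]) (simp add: norm_smul)
  then show ?thesis by (rule LIM_zero_cancel)
qed

lemma tendsto_proj: "(u \<longlongrightarrow> f) F \<Longrightarrow> ((\<lambda>i. P B (u i)) \<longlongrightarrow> P B f) F"
  unfolding proj_def
  by (intro tendsto_sum tendsto_smul_left bounded_linear.tendsto[OF bounded_linear_coord])

lemma closure_X_fin: "closure (X_fin smul e) = UNIV"
proof -
  have "subspace (X_fin smul e)"
  proof (rule subspaceI)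
    show "x + y \<in> X_fin smul e" if "x \<in> X_fin smul e" "y \<in> X_fin smul e" for x y
    proof -
      have "spt (x + y) \<subseteq> spt x \<union> spt y" by (auto simp: supp_def coord_linear)
      then show ?thesis using that by (auto simp: X_fin_def intro: finite_subset)
    qed
    show "smul c x \<in> X_fin smul e" if "x \<in> X_fin smul e" for c x
    proof -
      have "spt (smul c x) \<subseteq> spt x" by (auto simp: supp_def coord_smul)
      then show ?thesis using that by (auto simp: X_fin_def intro: finite_subset)
    qed
  qed (simp add: X_fin_def supp_def coord_linear)
  moreover have "range e \<subseteq> X_fin smul e"
    by (auto simp: X_fin_def supp_def coord_basis)
  ultimately have "span (range e) \<subseteq> X_fin smul e" by (intro span_minimal)
  then have "closure (span (range e)) \<subseteq> closure (X_fin smul e)" by (rule closure_mono)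
  moreover have "closure (span (range e)) = UNIV"
    using basis by (simp add: semi_normalized_M_basis_def)
  ultimately show ?thesis by auto
qed

text \<open>
  Density alone gives approximants whose coordinates exceed those of \<open>f\<close> by a vanishing amount and
  may be nonzero on \<open>F\<close>. Removing the coordinates in \<open>F\<close> is continuous, and the excess
  is scaled away by a factor that tends to one. If the supremum of the moduli is zero, no
  such factor exists, but then \<open>f = 0\<close> because the coordinate functionals separate points.
\<close>
lemma finitely_supported_approximation:
  assumes "finite F" "\<And>n. n \<in> F \<Longrightarrow> co n f = 0"
  obtains h :: "nat \<Rightarrow> 'a" where
    "\<And>i. finite (spt (h i))" "\<And>i n. norm (co n (h i)) \<le> coord_sup smul e f"
    "\<And>i n. n \<in> F \<Longrightarrow> co n (h i) = 0" "h \<longlonglongrightarrow> f"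
proof (cases "coord_sup smul e f = 0")
  case True
  then have "norm (co n f) \<le> 0" for n using coord_le_coord_sup[of n f] by simp
  then have "f = 0" by (intro coord_eqI) (simp add: coord_linear)
  with True show thesis by (intro that[of "\<lambda>_. 0"]) (auto simp: supp_def coord_linear)
next
  case False
  define c where "c = coord_sup smul e f"
  have le_c: "norm (co n f) \<le> c" for n unfolding c_def by (rule coord_le_coord_sup)
  have c: "c > 0"
    using False norm_ge_zero[of "co 0 f"] le_c[of 0] unfolding c_def by linarith
  obtain K where K: "K > 0" "\<And>n x. norm (co n x) \<le> K * norm x"
    using coord_uniform_bound by blast
  obtain u where u: "\<And>i. u i \<in> X_fin smul e" "u \<longlonglongrightarrow> f"
    using closure_X_fin closure_sequential[of f "X_fin smul e"] by auto
  have "P F f = 0" using assms by (simp add: proj_def)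
  define v where "v = (\<lambda>i. u i - P F (u i))"
  have v: "v \<longlonglongrightarrow> f"
    using tendsto_diff[OF u(2) tendsto_proj[OF u(2), of F]] \<open>P F f = 0\<close> by (simp add: v_def)
  have cov: "co n (v i) = (if n \<in> F then 0 else co n (u i))" for n i
    using assms(1) by (simp add: v_def coord_linear coord_proj)
  define s where "s = (\<lambda>i. c + K * norm (v i - f))"
  have s_pos: "s i > 0" for i using c K(1) by (simp add: s_def add_pos_nonneg)
  have v_le: "norm (co n (v i)) \<le> s i" for n i
  proof -
    have "co n (v i) = co n f + co n (v i - f)" by (simp add: coord_linear)
    then have "norm (co n (v i)) \<le> norm (co n f) + norm (co n (v i - f))"
      by (metis norm_triangle_ineq)
    then show ?thesis using le_c[of n] K(2)[of n "v i - f"] by (simp add: s_def)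
  qed
  have "(\<lambda>i. norm (v i - f)) \<longlonglongrightarrow> 0"
    using v by (simp add: LIM_zero tendsto_norm_zero)
  then have "s \<longlonglongrightarrow> c"
    unfolding s_def using tendsto_add[OF tendsto_const tendsto_mult[OF tendsto_const]]
    by fastforce
  then have "(\<lambda>i. (c / s i) *\<^sub>R v i) \<longlonglongrightarrow> (c / c) *\<^sub>R f"
    using c v by (intro tendsto_intros) auto
  then have lim: "(\<lambda>i. (c / s i) *\<^sub>R v i) \<longlonglongrightarrow> f" using c by simp
  show thesis
  proof (rule that[OF _ _ _ lim])
    show "finite (spt ((c / s i) *\<^sub>R v i))" for i
      using u(1)[of i] by (rule_tac finite_subset[of _ "spt (u i)"])
        (auto simp: supp_def X_fin_def coord_linear cov split: if_splits)
    show "norm (co n ((c / s i) *\<^sub>R v i)) \<le> coord_sup smul e f" for n i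
    proof -
      have "norm (co n ((c / s i) *\<^sub>R v i)) = c * (norm (co n (v i)) / s i)"
        using c s_pos[of i] by (simp add: coord_linear)
      also have "\<dots> \<le> c * 1"
        using v_le[of n i] s_pos[of i] c by (intro mult_left_mono) auto
      finally show ?thesis by (simp add: c_def)
    qed
    show "co n ((c / s i) *\<^sub>R v i) = 0" if "n \<in> F" for n i
      using that by (simp add: coord_linear cov)
  qed
qed

section \<open>Almost-greedy bases have Property \<open>F\<^sup>*\<close>\<close>

lemma almost_greedy_with_le:
  assumes "almost_greedy_with smul e C" "greedy_set smul e m f A" "finite B" "card B \<le> m"
  shows "norm (f - P A f) \<le> C * norm (f - P B f)"
proof -
  have "P A f \<in> greedy_sums smul e m f" using assms(2) by (auto simp: greedy_sums_def)
  then have "norm (f - P A f) \<le> C * (INF B\<in>{B. finite B \<and> card B \<le> m}. norm (f - P B f))"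
    using assms(1) unfolding almost_greedy_with_def by blast
  moreover have "(INF B\<in>{B. finite B \<and> card B \<le> m}. norm (f - P B f)) \<le> norm (f - P B f)"
  proof (rule cINF_lower)
    show "bdd_below ((\<lambda>B. norm (f - P B f)) ` {B. finite B \<and> card B \<le> m})"
      by (rule bdd_belowI[of _ 0]) auto
  qed (use assms(3,4) in simp)
  then have "C * (INF B\<in>{B. finite B \<and> card B \<le> m}. norm (f - P B f)) \<le> C * norm (f - P B f)"
    using assms(1) by (intro mult_left_mono) (auto simp: almost_greedy_with_def)
  ultimately show ?thesis by (rule order_trans)
qed

lemma greedy_remainder_le:
  assumes "almost_greedy_with smul e C" "finite A"
    "\<And>n k. n \<in> A \<Longrightarrow> k \<notin> A \<Longrightarrow> norm (co k f) \<le> norm (co n f)"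
  shows "norm (f - P A f) \<le> C * norm f"
  using almost_greedy_with_le[of C "card A" f A "{}"] assms by (simp add: greedy_set_def proj_def)

lemma Fstar_if_almost_greedy:
  assumes C: "almost_greedy_with smul e C"
  shows "property_Fstar_with smul e (C * (1 + 2 * C))"
  unfolding property_Fstar_with_def
proof (intro conjI ballI impI)
  have C_pos: "C > 0" using C by (simp add: almost_greedy_with_def)
  then show "C * (1 + 2 * C) > 0" by simp
  fix f z y
  assume fin: "f \<in> X_fin smul e" "z \<in> X_fin smul e" "y \<in> X_fin smul e"
    and adm: "Fstar_admissible smul e f z y"
  define D where "D = {n \<in> spt y. norm (co n y) = 1}"
  define E where "E = {n \<in> spt y. norm (co n y) > 1}"
  have fin': "finite (spt y)" "finite (spt z)" "finite D" "finite E"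
    using fin by (auto simp: X_fin_def D_def E_def)
  have zero: "co n f = 0 \<or> co n z = 0" "co n f = 0 \<or> co n y = 0" "co n z = 0 \<or> co n y = 0" for n
    using adm unfolding Fstar_admissible_def supp_def by blast+
  have small: "norm (co n f) \<le> 1" "norm (co n z) \<le> 1" for n
    using adm by (auto simp: Fstar_admissible_def coord_sup_le_iff)
  have card: "card (spt z) \<le> card D"
    using adm by (simp add: Fstar_admissible_def D_def)
  have y_large: "norm (co k f) \<le> norm (co n y)" if "n \<in> spt y" for n k
    using adm that coord_le_coord_sup[of k f]
    by (auto simp: Fstar_admissible_def le_INF_iff intro: order_trans)
  have zeroD: "co n z = 0" "co n f = 0" if "co n y \<noteq> 0" for n
    using zero[of n] that by auto

  have "f = (f + y) - P (spt y) (f + y)"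
    by (rule coord_eqI) (use fin' zeroD in \<open>auto simp: coord_linear coord_proj supp_def\<close>)
  moreover have "norm ((f + y) - P (spt y) (f + y)) \<le> C * norm (f + y)"
    using C fin'(1)
    by (rule greedy_remainder_le) (use y_large zeroD in \<open>auto simp: coord_linear supp_def\<close>)
  ultimately have f_le: "norm f \<le> C * norm (f + y)" by simp

  have "P D y = ((f + y) - P E (f + y)) - ((f + y) - P (D \<union> E) (f + y))"
    by (rule coord_eqI)
      (use fin' zeroD in \<open>auto simp: coord_linear coord_proj supp_def D_def E_def\<close>)
  moreover have "norm ((f + y) - P E (f + y)) \<le> C * norm (f + y)"
  proof (rule greedy_remainder_le[OF C fin'(4)])
    fix n k assume "n \<in> E" "k \<notin> E"
    then show "norm (co k (f + y)) \<le> norm (co n (f + y))"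
      using small(1)[of k] zero(2)[of k] zeroD[of n] by (auto simp: coord_linear E_def supp_def)
  qed
  moreover have "norm ((f + y) - P (D \<union> E) (f + y)) \<le> C * norm (f + y)"
  proof (rule greedy_remainder_le[OF C])
    fix n k assume "n \<in> D \<union> E" "k \<notin> D \<union> E"
    then show "norm (co k (f + y)) \<le> norm (co n (f + y))"
      using small(1)[of k] zero(2)[of k] zeroD[of n]
      by (auto simp: coord_linear D_def E_def supp_def)
  qed (use fin' in simp)
  ultimately have D_le: "norm (P D y) \<le> 2 * (C * norm (f + y))"
    using norm_triangle_ineq4[of "(f + y) - P E (f + y)" "(f + y) - P (D \<union> E) (f + y)"] by simp

  have "greedy_set smul e (card D) (z + P D y) D"
    using fin' small(2) zeroD
    by (auto simp: greedy_set_def coord_linear coord_proj D_def supp_def)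
  then have "norm ((z + P D y) - P D (z + P D y))
      \<le> C * norm ((z + P D y) - P (spt z) (z + P D y))"
    using C fin' card by (intro almost_greedy_with_le)
  moreover have "(z + P D y) - P D (z + P D y) = z"
    by (rule coord_eqI) (use fin' zeroD in \<open>auto simp: coord_linear coord_proj supp_def D_def\<close>)
  moreover have "(z + P D y) - P (spt z) (z + P D y) = P D y"
    by (rule coord_eqI) (use fin' zeroD in \<open>auto simp: coord_linear coord_proj supp_def D_def\<close>)
  ultimately have "norm z \<le> C * norm (P D y)" by simp
  also have "\<dots> \<le> C * (2 * (C * norm (f + y)))"
    using D_le C_pos by (intro mult_left_mono) auto
  finally have "norm (f + z) \<le> C * norm (f + y) + C * (2 * (C * norm (f + y)))"
    using f_le by (intro norm_triangle_le) simp
  then show "norm (f + z) \<le> C * (1 + 2 * C) * norm (f + y)"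
    by (simp add: algebra_simps)
qed

section \<open>Bases with Property \<open>F\<^sup>*\<close> are almost-greedy\<close>

text \<open>
  The conditions on the moduli are homogeneous apart from the normalisation to one, so any level
  \<open>t\<close> can replace it.
\<close>
lemma Fstar_rescaled:
  assumes F: "property_Fstar_with smul e C" and t: "t > 0"
    and fin: "finite (spt f)" "finite (spt z)" "finite (spt y)"
    and disj: "spt f \<inter> spt z = {}" "spt f \<inter> spt y = {}" "spt z \<inter> spt y = {}"
    and small: "\<And>n. norm (co n f) \<le> t" "\<And>n. norm (co n z) \<le> t"
    and card: "card (spt z) \<le> card {n \<in> spt y. norm (co n y) = t}"
    and y_large: "\<And>n k. n \<in> spt y \<Longrightarrow> norm (co k f) \<le> norm (co n y)"
  shows "norm (f + z) \<le> C * norm (f + y)"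
proof -
  have spt: "spt ((1/t) *\<^sub>R x) = spt x" for x
    using t by (auto simp: supp_def coord_linear)
  have co: "norm (co n ((1/t) *\<^sub>R x)) = norm (co n x) / t" for n x
    using t by (simp add: coord_linear)
  have "coord_sup smul e ((1/t) *\<^sub>R f) \<le> norm (co n y) / t" if "n \<in> spt y" for n
    using y_large[OF that] t by (simp add: coord_sup_le_iff co divide_right_mono del: norm_scaleR)
  moreover have level: "norm (co n y) / t = 1 \<longleftrightarrow> norm (co n y) = t" for n
    using t by auto
  ultimately have "Fstar_admissible smul e ((1/t) *\<^sub>R f) ((1/t) *\<^sub>R z) ((1/t) *\<^sub>R y)"
    using disj small card t
    by (simp add: Fstar_admissible_def spt co coord_sup_le_iff le_INF_iff level
        del: norm_scaleR)
  then have "norm ((1/t) *\<^sub>R f + (1/t) *\<^sub>R z) \<le> C * norm ((1/t) *\<^sub>R f + (1/t) *\<^sub>R y)"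
    using F fin by (simp add: property_Fstar_with_def X_fin_def spt)
  then have "norm ((1/t) *\<^sub>R (f + z)) \<le> C * norm ((1/t) *\<^sub>R (f + y))"
    by (simp add: scaleR_add_right)
  then show ?thesis using t by (simp add: divide_le_cancel)
qed

text \<open>
  In the hypotheses \<open>f\<close> occurs only through its support, which must avoid those of \<open>z\<close> and \<open>y\<close>, and
  through upper bounds on its coordinates. The approximants found above preserve both.
\<close>
lemma Fstar_infinite_support:
  assumes F: "property_Fstar_with smul e C" and t: "t > 0"
    and fin: "finite (spt z)" "finite (spt y)"
    and disj: "spt f \<inter> spt z = {}" "spt f \<inter> spt y = {}" "spt z \<inter> spt y = {}"
    and small: "\<And>n. norm (co n f) \<le> t" "\<And>n. norm (co n z) \<le> t"
    and card: "card (spt z) \<le> card {n \<in> spt y. norm (co n y) = t}"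
    and y_large: "\<And>n k. n \<in> spt y \<Longrightarrow> norm (co k f) \<le> norm (co n y)"
  shows "norm (f + z) \<le> C * norm (f + y)"
proof -
  obtain h where h: "\<And>i. finite (spt (h i))" "\<And>i n. norm (co n (h i)) \<le> coord_sup smul e f"
    "\<And>i n. n \<in> spt z \<union> spt y \<Longrightarrow> co n (h i) = 0" "h \<longlonglongrightarrow> f"
    by (rule finitely_supported_approximation[of "spt z \<union> spt y" f])
      (use fin disj in \<open>auto simp: supp_def\<close>)
  have "norm (h i + z) \<le> C * norm (h i + y)" for i
  proof (rule Fstar_rescaled[OF F t h(1) fin])
    show "spt (h i) \<inter> spt z = {}" "spt (h i) \<inter> spt y = {}"
      using h(3)[of _ i] by (auto simp: supp_def)
    show "norm (co n (h i)) \<le> t" for n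
      using h(2)[of n i] small(1) coord_sup_le_iff order_trans by blast
    show "norm (co k (h i)) \<le> norm (co n y)" if "n \<in> spt y" for n k
      using h(2)[of k i] y_large[OF that] coord_sup_le_iff order_trans by blast
  qed (use disj small card in auto)
  moreover have "(\<lambda>i. norm (h i + z)) \<longlonglongrightarrow> norm (f + z)"
    "(\<lambda>i. C * norm (h i + y)) \<longlonglongrightarrow> C * norm (f + y)"
    by (intro tendsto_intros h(4))+
  ultimately show ?thesis by (auto intro: LIMSEQ_le)
qed

lemma Fstar_delete_large_coordinates:
  assumes F: "property_Fstar_with smul e C"
    and "finite (spt y)" "spt f \<inter> spt y = {}"
    and "\<And>n k. n \<in> spt y \<Longrightarrow> norm (co k f) \<le> norm (co n y)"
  shows "norm f \<le> C * norm (f + y)"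
proof -
  have le: "norm (co n f) \<le> coord_sup smul e f + 1" for n
    using coord_le_coord_sup[of n f] by simp
  \<comment> \<open>For \<open>z = 0\<close> any positive upper bound for the coordinates of \<open>f\<close> serves as the level; adding one
    makes the supremum positive also if \<open>f = 0\<close>.\<close>
  have pos: "coord_sup smul e f + 1 > 0"
    using coord_le_coord_sup[of 0 f] norm_ge_zero[of "co 0 f"] by linarith
  have "norm (f + 0) \<le> C * norm (f + y)"
    by (rule Fstar_infinite_support[OF F pos])
      (use assms le pos in \<open>auto simp: supp_def coord_linear\<close>)
  then show ?thesis by simp
qed

text \<open>
  Truncation at the level \<open>t\<close> multiplies the coordinate at \<open>n\<close> by \<open>t / |e\<^sub>n\<^sup>*(f)|\<close>. The larger the
  modulus, the smaller this weight, so the layers of the weights arise by deleting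
  coordinates that dominate all the remaining ones.
\<close>
lemma Fstar_truncation:
  assumes F: "property_Fstar_with smul e C" and t: "t > 0" and A: "finite A"
    and g: "\<And>n. n \<in> A \<Longrightarrow> co n g = 0" "\<And>n. norm (co n g) \<le> t"
    and large: "\<And>n. n \<in> A \<Longrightarrow> t \<le> norm (co n f)"
  shows "norm (g + (\<Sum>n\<in>A. (t / norm (co n f)) *\<^sub>R smul (co n f) (e n))) \<le> C * norm (g + P A f)"
proof (rule norm_layered_combination_le[OF A])
  fix n assume "n \<in> A"
  then show "0 \<le> t / norm (co n f) \<and> t / norm (co n f) \<le> 1"
    using large[of n] t by (auto simp: divide_simps)
next
  fix S
  assume S: "S \<subseteq> A" "\<And>k n. k \<in> S \<Longrightarrow> n \<in> A - S \<Longrightarrow> t / norm (co n f) \<le> t / norm (co k f)"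
  have fin: "finite S" "finite (A - S)" using S(1) A finite_subset by auto
  have ord: "norm (co k f) \<le> norm (co n f)" if "k \<in> S" "n \<in> A - S" for k n
  proof -
    have "t / norm (co n f) \<le> t / norm (co k f)" using S(2) that .
    moreover have "0 < norm (co k f)" "0 < norm (co n f)"
      using large[of k] large[of n] t that S(1) by auto
    ultimately show ?thesis using t by (simp add: divide_simps split: if_splits)
  qed
  have co_gS: "co k (g + P S f) = (if k \<in> S then co k f else co k g)" for k
    using g(1)[of k] S(1) fin by (auto simp: coord_linear coord_proj)
  have supp_rest: "spt (P (A - S) f) \<subseteq> A - S"
    using fin(2) by (auto simp: supp_def coord_proj split: if_splits)
  have "norm (g + P S f) \<le> C * norm ((g + P S f) + P (A - S) f)"
  proof (rule Fstar_delete_large_coordinates[OF F])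
    show "finite (spt (P (A - S) f))" using supp_rest fin(2) by (rule finite_subset)
    show "spt (g + P S f) \<inter> spt (P (A - S) f) = {}"
      using supp_rest g(1) by (auto simp: supp_def co_gS split: if_splits)
    fix n k assume "n \<in> spt (P (A - S) f)"
    then have n: "n \<in> A - S" using supp_rest by auto
    then have "co n (P (A - S) f) = co n f" using fin(2) by (simp add: coord_proj)
    moreover have "norm (co k g) \<le> norm (co n f)"
      using g(2)[of k] large[of n] n by auto
    ultimately show "norm (co k (g + P S f)) \<le> norm (co n (P (A - S) f))"
      using ord n by (simp add: co_gS)
  qed
  also have "(g + P S f) + P (A - S) f = g + P A f"
    by (rule coord_eqI) (use fin A S(1) in \<open>auto simp: coord_linear coord_proj\<close>)
  finally show "norm (g + (\<Sum>n\<in>S. smul (co n f) (e n))) \<le> C * norm (g + P A f)"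
    by (simp add: proj_def)
qed

lemma greedy_le_projection_if_Fstar:
  assumes F: "property_Fstar_with smul e C"
    and G: "greedy_set smul e m f A" and B: "finite B" "card B \<le> m"
  shows "norm (f - P A f) \<le> C\<^sup>2 * norm (f - P B f)"
proof -
  have C: "C > 0" using F by (simp add: property_Fstar_with_def)
  have A: "finite A" "card A = m"
    and greedy: "\<And>n k. n \<in> A \<Longrightarrow> k \<notin> A \<Longrightarrow> norm (co k f) \<le> norm (co n f)"
    using G by (auto simp: greedy_set_def)
  obtain t where t: "\<And>n. n \<in> A \<Longrightarrow> t \<le> norm (co n f)" "\<And>k. k \<notin> A \<Longrightarrow> norm (co k f) \<le> t"
  proof (cases "A = {}")
    case True
    then show thesis using that[of "coord_sup smul e f"] coord_le_coord_sup by auto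
  next
    case False
    then obtain a where "a \<in> A" "\<And>n. n \<in> A \<Longrightarrow> norm (co a f) \<le> norm (co n f)"
      using A(1) arg_min_if_finite(1)[of A "\<lambda>n. norm (co n f)"]
        arg_min_least[of A _ "\<lambda>n. norm (co n f)"] by blast
    then show thesis using that[of "norm (co a f)"] greedy by blast
  qed
  show ?thesis
  proof (cases "t > 0")
    case False
    \<comment> \<open>Then \<open>f\<close> vanishes off \<open>A\<close>.\<close>
    have "f = P A f"
    proof (rule coord_eqI)
      fix n
      have "co n f = 0" if "n \<notin> A"
        using t(2)[OF that] False by (metis norm_le_zero_iff order_trans not_less)
      then show "co n f = co n (P A f)" using A(1) by (simp add: coord_proj)
    qed
    then show ?thesis by simp
  next
    case True
    define g where "g = f - P (A \<union> B) f"
    define y where "y = (\<Sum>n\<in>A-B. (t / norm (co n f)) *\<^sub>R smul (co n f) (e n))"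
    define z where "z = P (B - A) f"
    have co_g: "co n g = (if n \<in> A \<union> B then 0 else co n f)" for n
      using A B by (simp add: g_def coord_linear coord_proj)
    have co_z: "co n z = (if n \<in> B - A then co n f else 0)" for n
      using B by (simp add: z_def coord_proj)
    have y_eq: "y = (\<Sum>n\<in>A-B. smul (of_real (t / norm (co n f)) * co n f) (e n))"
      unfolding y_def by (rule sum.cong) (simp_all flip: smul_of_real)
    have co_y: "co n y = (if n \<in> A - B then of_real (t / norm (co n f)) * co n f else 0)" for n
      unfolding y_eq using A(1) by (intro coord_combination) simp
    have norm_y: "norm (co n y) = t" if "n \<in> A - B" for n
      using that t(1)[of n] True by (auto simp: co_y norm_mult norm_divide)
    have spt_y: "spt y = A - B"
    proof
      show "spt y \<subseteq> A - B" by (auto simp: supp_def co_y split: if_splits)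
      show "A - B \<subseteq> spt y" unfolding supp_def using norm_y True by force
    qed
    have spt_z: "spt z \<subseteq> B - A" by (auto simp: supp_def co_z split: if_splits)
    have g_le: "norm (co n g) \<le> t" for n using t(2)[of n] True by (simp add: co_g)
    have "norm (g + z) \<le> C * norm (g + y)"
    proof (rule Fstar_infinite_support[OF F True])
      show "finite (spt z)" using spt_z B(1) by (metis finite_Diff finite_subset)
      show "finite (spt y)" using spt_y A(1) by simp
      show "spt g \<inter> spt z = {}" "spt g \<inter> spt y = {}" "spt z \<inter> spt y = {}"
        using spt_z by (auto simp: spt_y supp_def co_g co_y split: if_splits)
      show "norm (co n g) \<le> t" for n by (rule g_le)
      show "norm (co n z) \<le> t" for n using t(2)[of n] True by (simp add: co_z)
      have "card (spt z) \<le> card (B - A)" using spt_z B(1) by (intro card_mono) auto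
      also have "\<dots> \<le> card (A - B)"
        using A B card_le_sym_Diff[of B A] by simp
      also have "A - B = {n \<in> spt y. norm (co n y) = t}"
        using norm_y by (auto simp: spt_y)
      finally show "card (spt z) \<le> card {n \<in> spt y. norm (co n y) = t}" .
      show "norm (co k g) \<le> norm (co n y)" if "n \<in> spt y" for n k
        using that norm_y g_le by (simp add: spt_y)
    qed
    also have "norm (g + y) \<le> C * norm (g + P (A - B) f)"
      unfolding y_def using A(1) t(1) g_le
      by (intro Fstar_truncation[OF F True]) (auto simp: co_g)
    finally have "norm (g + z) \<le> C\<^sup>2 * norm (g + P (A - B) f)"
      using C by (simp add: power2_eq_square mult.assoc)
    moreover have "g + z = f - P A f"
      by (rule coord_eqI) (use A(1) in \<open>simp add: co_g co_z coord_linear coord_proj\<close>)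
    moreover have "g + P (A - B) f = f - P B f"
      by (rule coord_eqI) (use A(1) B(1) in \<open>simp add: co_g coord_linear coord_proj\<close>)
    ultimately show ?thesis by simp
  qed
qed

lemma almost_greedy_if_Fstar:
  assumes F: "property_Fstar_with smul e C"
  shows "almost_greedy_with smul e (C\<^sup>2)"
  unfolding almost_greedy_with_def
proof (intro conjI allI ballI)
  show C: "C\<^sup>2 > 0" using F by (simp add: property_Fstar_with_def)
  fix m f g assume "g \<in> greedy_sums smul e m f"
  then obtain A where A: "greedy_set smul e m f A" "g = P A f"
    by (auto simp: greedy_sums_def)
  have "norm (f - g) / C\<^sup>2 \<le> (INF B\<in>{B. finite B \<and> card B \<le> m}. norm (f - P B f))"
  proof (rule cINF_greatest)
    show "{B :: nat set. finite B \<and> card B \<le> m} \<noteq> {}" by (auto intro: exI[of _ "{}"])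
    show "norm (f - g) / C\<^sup>2 \<le> norm (f - P B f)" if "B \<in> {B. finite B \<and> card B \<le> m}" for B
      using greedy_le_projection_if_Fstar[OF F A(1), of B] that A(2) C
      by (simp add: pos_divide_le_eq mult.commute)
  qed
  then show "norm (f - g) \<le> C\<^sup>2 * (INF B\<in>{B. finite B \<and> card B \<le> m}. norm (f - P B f))"
    using C by (simp add: pos_divide_le_eq mult.commute)
qed

end

section \<open>The equivalence with its constants\<close>

theorem theorem1p13:
  fixes smul :: "'k::real_normed_field \<Rightarrow> 'a::banach \<Rightarrow> 'a"
    and e :: "nat \<Rightarrow> 'a"
  assumes "banach_space_over smul"
    and "semi_normalized_M_basis smul e"
  shows "(almost_greedy smul e \<longrightarrow>
            property_Fstar smul e \<and>
            Fstar_const smul e \<le> C_al smul e * (1 + 2 * C_al smul e)) \<and>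
         (property_Fstar smul e \<longrightarrow>
            almost_greedy smul e \<and>
            C_al smul e \<le> (Fstar_const smul e)\<^sup>2)"
proof -
  interpret M_basis_over smul e
    using assms by (simp add: M_basis_over_def M_basis_over_axioms_def)
  have bdd: "bdd_below {C. almost_greedy_with smul e C}" "bdd_below {C. property_Fstar_with smul e C}"
    by (rule bdd_belowI[of _ 0], simp add: almost_greedy_with_def property_Fstar_with_def)+
  show ?thesis
  proof (intro conjI impI)
    assume ag: "almost_greedy smul e"
    then show "property_Fstar smul e"
      using Fstar_if_almost_greedy by (auto simp: almost_greedy_def property_Fstar_def)
    show "Fstar_const smul e \<le> C_al smul e * (1 + 2 * C_al smul e)"
      unfolding C_al_def
    proof (rule le_continuous_at_Inf[where \<phi> = "\<lambda>C. C * (1 + 2 * C)"])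
      show "{C. almost_greedy_with smul e C} \<noteq> {}" using ag by (auto simp: almost_greedy_def)
      show "continuous_on UNIV (\<lambda>C::real. C * (1 + 2 * C))" by (intro continuous_intros)
      show "Fstar_const smul e \<le> C * (1 + 2 * C)" if "C \<in> {C. almost_greedy_with smul e C}" for C
        unfolding Fstar_const_def using that Fstar_if_almost_greedy bdd by (intro cInf_lower) auto
    qed (rule bdd)
  next
    assume F: "property_Fstar smul e"
    then show "almost_greedy smul e"
      using almost_greedy_if_Fstar by (auto simp: almost_greedy_def property_Fstar_def)
    show "C_al smul e \<le> (Fstar_const smul e)\<^sup>2"
      unfolding Fstar_const_def
    proof (rule le_continuous_at_Inf[where \<phi> = "\<lambda>C. C\<^sup>2"])
      show "{C. property_Fstar_with smul e C} \<noteq> {}" using F by (auto simp: property_Fstar_def)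
      show "continuous_on UNIV (\<lambda>C::real. C\<^sup>2)" by (intro continuous_intros)
      show "C_al smul e \<le> C\<^sup>2" if "C \<in> {C. property_Fstar_with smul e C}" for C
        unfolding C_al_def using that almost_greedy_if_Fstar bdd by (intro cInf_lower) auto
    qed (rule bdd)
  qed
qed

end
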